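(* Let $X$ be a metric space, $\Omega\subset\mathbb{R}$ a compact metric space, $U\subset\mathbb{R}$ a finite set, and let $f:X\times\Omega\times U\to X$ and $\sigma:X\to\mathbb{R}$ be continuous functions. For $\tau\in\mathbb{Z}_+$ let $V_\tau:X\to\mathbb{R}_+$ be the function defined in the context, and let $V_\infty(\bar x)=\sup_{\tau\in\mathbb{Z}_+}V_\tau(\bar x)$ for $\bar x\in X$. Then the following statements are equivalent: (i) $V_\infty(\bar x)<\infty$ for all $\bar x\in X$. (ii) The sequence of functions $\Lambda_k:X\to\mathbb{R}_+$ defined by $\Lambda_0\equiv 0$ and $$\Lambda_{k+1}(x)=\max\Big\{0,\ \sigma(x)+\min_{r\in\Omega}\max_{u\in U}\Lambda_k(f(x,r,u))\Big\}$$ converges pointwise to a limit $\Lambda_\infty:X\to\mathbb{R}_+$. (iii) There exists a function $V:X\to\mathbb{R}_+$ such that $$V(x)=\max\Big\{0,\ \sigma(x)+\min_{r\in\Omega}\max_{u\in U}V(f(x,r,u))\Big\}\quad\text{for every }x\in X.$$ (iv) There exists a function $V:X\to\mathbb{R}_+$ such that $$V(x)\ge\sigma(x)+\min_{r\in\Omega}\max_{u\in U}V(f(x,r,u))\quad\text{for every }x\in X.$$ Moreover, if conditions (i)--(iv) hold, then $V_\infty$ is a solution of the equation in (iii); $V_\infty=\Lambda_\infty\ge V_k=\Lambda_k$ for all $k\in\mathbb{Z}_+$; and $V\ge V_\infty$ for every $V:X\to\mathbb{R}_+$ satisfying the equation in (iii). Furthermore, for every $x_n$ satisfying $x_{n+1}=f(x_n,r_n,u_n)$,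 $x_0=\bar x$, for all $n\in\mathbb{Z}_+$ (with $\bar x\in X$, $r_n\in\Omega$, $u_n\in U$), one has $$\sup_{\tau}\sum_{n=0}^{\tau-1}\sigma(x_n)<\infty.$$
   Context: $\mathbb{Z}_+=\{0,1,2,\dots\}$ and $\mathbb{R}_+=[0,\infty)$. Inequalities and equalities between functions on $X$ are pointwise. Definition of $V_\tau$: for $\bar x\in X$ and sequences $r_n\in\Omega$, $u_n\in U$, $\theta_n\in\{0,1\}$, define $x_n\in X$ and $h_n\in\{0,1\}$ by $$x_{n+1}=f(x_n,r_n,u_n),\quad x_0=\bar x,\qquad h_{n+1}=\theta_n h_n,\quad h_0=1\qquad(n\in\mathbb{Z}_+).$$ Then $$V_\tau(\bar x)=\max_{\theta_0}\ \min_{r_0}\ \max_{u_0,\theta_1}\ \cdots\ \min_{r_{\tau-2}}\ \max_{u_{\tau-2},\theta_{\tau-1}}\ \sum_{n=0}^{\tau-1}h_{n+1}\sigma(x_n),$$ where the optimizations are over $\theta_n\in\{0,1\}$, $r_n\in\Omega$, $u_n\in U$. In particular $V_0\equiv 0$ and $V_1(\bar x)=\max\{0,\sigma(\bar x)\}$.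
   Formalization: The final bound is false for arbitrary r_n (X=R, Ω={0,1}, U={0}, f=r, σ(x)=x, r_n=1); it is proved for r_n attaining min over r of max over u of V(f(x_n,r,u)), with V any function as in (iv) and u_n arbitrary. Ω and U are taken nonempty. *)

theory Defs
  imports "HOL-Analysis.Analysis"
begin

text \<open>A genuine minimum, not an infimum: the value is unspecified unless the minimum is attained.\<close>

definition min_over :: "real set \<Rightarrow> (real \<Rightarrow> real) \<Rightarrow> real" where
  "min_over \<Omega> g = (LEAST m. m \<in> g ` \<Omega>)"

definition attains_min_at :: "real set \<Rightarrow> (real \<Rightarrow> real) \<Rightarrow> real \<Rightarrow> bool" where
  "attains_min_at \<Omega> g r \<longleftrightarrow> is_arg_min g (\<lambda>s. s \<in> \<Omega>) r"

primrec state_seq ::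
  "('a \<Rightarrow> real \<Rightarrow> real \<Rightarrow> 'a) \<Rightarrow> 'a \<Rightarrow> (nat \<Rightarrow> real) \<Rightarrow> (nat \<Rightarrow> real) \<Rightarrow> nat \<Rightarrow> 'a" where
  "state_seq f xbar r u 0 = xbar"
| "state_seq f xbar r u (Suc n) = f (state_seq f xbar r u n) (r n) (u n)"

primrec stop_seq :: "(nat \<Rightarrow> real) \<Rightarrow> nat \<Rightarrow> real" where
  "stop_seq \<theta> 0 = 1"
| "stop_seq \<theta> (Suc n) = \<theta> n * stop_seq \<theta> n"

definition payoff ::
  "('a \<Rightarrow> real \<Rightarrow> real \<Rightarrow> 'a) \<Rightarrow> ('a \<Rightarrow> real) \<Rightarrow> nat \<Rightarrow> 'a
    \<Rightarrow> (nat \<Rightarrow> real) \<Rightarrow> (nat \<Rightarrow> real) \<Rightarrow> (nat \<Rightarrow> real) \<Rightarrow> real" where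
  "payoff f \<sigma> \<tau> xbar \<theta> r u =
     (\<Sum>n<\<tau>. stop_seq \<theta> (Suc n) * \<sigma> (state_seq f xbar r u n))"

text \<open>
  \<open>stages \<Omega> U J k n\<close> is the block of \<open>k\<close> nested optimizations
  \<open>min r\<^sub>n max (u\<^sub>n, \<theta>\<^sub>n\<^sub>+\<^sub>1) \<dots>\<close> ending with index \<open>n + k - 1\<close> for \<open>r\<close> and \<open>u\<close>, applied to
  the objective \<open>J\<close>. The sequences carry the choices already made.
\<close>

primrec stages ::
  "real set \<Rightarrow> real set \<Rightarrow> ((nat \<Rightarrow> real) \<Rightarrow> (nat \<Rightarrow> real) \<Rightarrow> (nat \<Rightarrow> real) \<Rightarrow> real) \<Rightarrow> nat \<Rightarrow> nat
    \<Rightarrow> (nat \<Rightarrow> real) \<Rightarrow> (nat \<Rightarrow> real) \<Rightarrow> (nat \<Rightarrow> real) \<Rightarrow> real" where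
  "stages \<Omega> U J 0 n \<theta> r u = J \<theta> r u"
| "stages \<Omega> U J (Suc k) n \<theta> r u =
     min_over \<Omega> (\<lambda>rn. MAX (un, t) \<in> U \<times> {0, 1}.
       stages \<Omega> U J k (Suc n) (\<theta>(Suc n := t)) (r(n := rn)) (u(n := un)))"

text \<open>
  The initial zero sequences are placeholders: every entry on which the payoff depends is
  overwritten by one of the optimizations.
\<close>

primrec game_value ::
  "('a \<Rightarrow> real \<Rightarrow> real \<Rightarrow> 'a) \<Rightarrow> ('a \<Rightarrow> real) \<Rightarrow> real set \<Rightarrow> real set \<Rightarrow> nat \<Rightarrow> 'a \<Rightarrow> real" where
  "game_value f \<sigma> \<Omega> U 0 xbar = 0"
| "game_value f \<sigma> \<Omega> U (Suc k) xbar =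
     (MAX t \<in> {0, 1}.
        stages \<Omega> U (payoff f \<sigma> (Suc k) xbar) k 0 ((\<lambda>_. 0)(0 := t)) (\<lambda>_. 0) (\<lambda>_. 0))"

definition game_value_sup ::
  "('a \<Rightarrow> real \<Rightarrow> real \<Rightarrow> 'a) \<Rightarrow> ('a \<Rightarrow> real) \<Rightarrow> real set \<Rightarrow> real set \<Rightarrow> 'a \<Rightarrow> ereal" where
  "game_value_sup f \<sigma> \<Omega> U xbar = (SUP \<tau>. ereal (game_value f \<sigma> \<Omega> U \<tau> xbar))"

definition worst_next ::
  "('a \<Rightarrow> real \<Rightarrow> real \<Rightarrow> 'a) \<Rightarrow> real set \<Rightarrow> ('a \<Rightarrow> real) \<Rightarrow> 'a \<Rightarrow> real \<Rightarrow> real" where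
  "worst_next f U V x r = (MAX u \<in> U. V (f x r u))"

primrec value_iter ::
  "('a \<Rightarrow> real \<Rightarrow> real \<Rightarrow> 'a) \<Rightarrow> ('a \<Rightarrow> real) \<Rightarrow> real set \<Rightarrow> real set \<Rightarrow> nat \<Rightarrow> 'a \<Rightarrow> real" where
  "value_iter f \<sigma> \<Omega> U 0 x = 0"
| "value_iter f \<sigma> \<Omega> U (Suc k) x =
     max 0 (\<sigma> x + min_over \<Omega> (worst_next f U (value_iter f \<sigma> \<Omega> U k) x))"

definition value_iter_limit ::
  "('a \<Rightarrow> real \<Rightarrow> real \<Rightarrow> 'a) \<Rightarrow> ('a \<Rightarrow> real) \<Rightarrow> real set \<Rightarrow> real set \<Rightarrow> ('a \<Rightarrow> real) \<Rightarrow> bool" where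
  "value_iter_limit f \<sigma> \<Omega> U L \<longleftrightarrow>
     (\<forall>x. 0 \<le> L x) \<and> (\<forall>x. (\<lambda>k. value_iter f \<sigma> \<Omega> U k x) \<longlonglongrightarrow> L x)"

text \<open>
  In the next two definitions \<open>V\<close> need not be continuous, so the existence of the minimum
  is part of the condition.
\<close>

definition bellman_solution ::
  "('a \<Rightarrow> real \<Rightarrow> real \<Rightarrow> 'a) \<Rightarrow> ('a \<Rightarrow> real) \<Rightarrow> real set \<Rightarrow> real set \<Rightarrow> ('a \<Rightarrow> real) \<Rightarrow> bool" where
  "bellman_solution f \<sigma> \<Omega> U V \<longleftrightarrow>
     (\<forall>x. 0 \<le> V x) \<and>
     (\<forall>x. (\<exists>r. attains_min_at \<Omega> (worst_next f U V x) r) \<and>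
          V x = max 0 (\<sigma> x + min_over \<Omega> (worst_next f U V x)))"

definition bellman_supersolution ::
  "('a \<Rightarrow> real \<Rightarrow> real \<Rightarrow> 'a) \<Rightarrow> ('a \<Rightarrow> real) \<Rightarrow> real set \<Rightarrow> real set \<Rightarrow> ('a \<Rightarrow> real) \<Rightarrow> bool" where
  "bellman_supersolution f \<sigma> \<Omega> U V \<longleftrightarrow>
     (\<forall>x. 0 \<le> V x) \<and>
     (\<forall>x. (\<exists>r. attains_min_at \<Omega> (worst_next f U V x) r) \<and>
          V x \<ge> \<sigma> x + min_over \<Omega> (worst_next f U V x))"

text \<open>
  Trajectories in which the minimizing player chooses \<open>r\<^sub>n\<close> as a minimizer for \<open>V\<close>, while
  \<open>u\<^sub>n\<close> is arbitrary. The bound on the partial sums of \<open>\<sigma> (x\<^sub>n)\<close> is stated for these trajectories,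
  with \<open>V\<close> any supersolution, and not for arbitrary \<open>r\<^sub>n \<in> \<Omega>\<close>, for which it is false:
  for \<open>f x r u = r\<close>, \<open>\<sigma> x = x\<close> on the real line, \<open>\<Omega> = {0, 1}\<close> and \<open>U = {0}\<close>, the function
  \<open>max 0 x\<close> is a Bellman solution, but \<open>r\<^sub>n = 1\<close> gives \<open>x\<^sub>n = 1\<close> for \<open>n \<ge> 1\<close> and unbounded
  partial sums.
\<close>

definition minimizing_trajectory ::
  "('a \<Rightarrow> real \<Rightarrow> real \<Rightarrow> 'a) \<Rightarrow> real set \<Rightarrow> real set \<Rightarrow> ('a \<Rightarrow> real)
    \<Rightarrow> (nat \<Rightarrow> 'a) \<Rightarrow> (nat \<Rightarrow> real) \<Rightarrow> (nat \<Rightarrow> real) \<Rightarrow> bool" where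
  "minimizing_trajectory f \<Omega> U V x r u \<longleftrightarrow>
     (\<forall>n. r n \<in> \<Omega> \<and> u n \<in> U \<and> x (Suc n) = f (x n) (r n) (u n) \<and>
          attains_min_at \<Omega> (worst_next f U V (x n)) (r n))"

end

(*
  Writing h_(n+1) = theta_n h_n with h in {0, 1}, stopping at time n contributes 0 and continuing
  contributes sigma (x_n) plus the value of the remaining game, so dynamic programming gives
  V_k = Lambda_k.  By induction every Lambda_k lies below every nonnegative supersolution.
  The sequence Lambda_k is increasing, and each Lambda_k is lower semicontinuous; this is all that
  is needed for minima over Omega to be attained and, by the finite intersection property, for
  sup_k to commute with min_r.  Hence a finite pointwise limit solves the Bellman equation.
*)
theory Submission
  imports Defs
begin

section \<open>Minima and maxima\<close>

lemma attains_min_at_iff: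
  "attains_min_at \<Omega> g r \<longleftrightarrow> r \<in> \<Omega> \<and> (\<forall>s\<in>\<Omega>. g r \<le> g s)"
  by (auto simp: attains_min_at_def is_arg_min_def not_less)

lemma min_over_eq:
  assumes "attains_min_at \<Omega> g r"
  shows "min_over \<Omega> g = g r"
  using assms unfolding min_over_def attains_min_at_iff by (intro Least_equality) auto

lemma min_over_le:
  assumes "attains_min_at \<Omega> g r" "s \<in> \<Omega>"
  shows "min_over \<Omega> g \<le> g s"
  using assms min_over_eq[OF assms(1)] by (simp add: attains_min_at_iff)

text \<open>Comparing at the minimizer \<open>s\<close> of the larger function suffices. Attainment
  is assumed on both sides because \<open>min_over\<close> is unspecified without it.\<close>

lemma min_over_mono:
  assumes "attains_min_at \<Omega> g r" "attains_min_at \<Omega> h s" "\<And>t. t \<in> \<Omega> \<Longrightarrow> g t \<le> h t"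
  shows "min_over \<Omega> g \<le> min_over \<Omega> h"
proof -
  have s: "s \<in> \<Omega>"
    using assms(2) by (simp add: attains_min_at_iff)
  have "min_over \<Omega> g \<le> g s"
    using assms(1) s by (rule min_over_le)
  also have "\<dots> \<le> h s"
    using s by (rule assms(3))
  also have "\<dots> = min_over \<Omega> h"
    using min_over_eq[OF assms(2)] by simp
  finally show ?thesis .
qed

text \<open>In the game, \<open>c\<close> will be the payoff already fixed and \<open>h\<close> the
  stopping factor; a nonnegative factor keeps the same minimizer, even when it is 0.\<close>

lemma min_over_affine:
  assumes "attains_min_at \<Omega> g r" "0 \<le> h"
  shows "min_over \<Omega> (\<lambda>s. c + h * g s) = c + h * min_over \<Omega> g"
proof -
  have "attains_min_at \<Omega> (\<lambda>s. c + h * g s) r"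
    using assms by (auto simp: attains_min_at_iff intro: mult_left_mono)
  then show ?thesis
    using min_over_eq[OF assms(1)] by (simp add: min_over_eq)
qed

text \<open>Weierstrass argument for lower semicontinuous functions: nonnegativity gives a finite
  infimum \<open>m\<close>, and the nonempty nested compact sublevels at heights decreasing to
  \<open>m\<close> share a point.\<close>

lemma attains_min_at_compact_sublevels:
  fixes \<Omega> :: "real set"
  assumes "\<Omega> \<noteq> {}" "\<And>s. s \<in> \<Omega> \<Longrightarrow> 0 \<le> g s" "\<And>a. compact {s \<in> \<Omega>. g s \<le> a}"
  shows "\<exists>r. attains_min_at \<Omega> g r"
proof -
  define m where "m = Inf (g ` \<Omega>)"
  define F where "F n = {s \<in> \<Omega>. g s \<le> m + 1 / real (Suc n)}" for n
  have lower: "m \<le> g s" if "s \<in> \<Omega>" for s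
    unfolding m_def using that assms(2) by (intro cInf_lower bdd_belowI[of _ 0]) auto
  have "F n \<noteq> {}" for n
  proof -
    have "Inf (g ` \<Omega>) < m + 1 / real (Suc n)"
      by (simp add: m_def)
    then obtain y where "y \<in> g ` \<Omega>" "y < m + 1 / real (Suc n)"
      using assms(1) cInf_lessD by (metis image_is_empty)
    then show ?thesis
      by (auto simp: F_def intro: less_imp_le)
  qed
  moreover have "F n \<subseteq> F k" if "k \<le> n" for k n
    using that frac_le[of 1 1 "real (Suc k)" "real (Suc n)"] by (auto simp: F_def)
  moreover have "compact (F n)" for n
    unfolding F_def by (rule assms(3))
  ultimately have "\<Inter> (range F) \<noteq> {}"
    by (intro compact_nest) auto
  then obtain r where r: "r \<in> \<Omega>" "\<And>n. g r \<le> m + 1 / real (Suc n)"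
    by (auto simp: F_def)
  have "g r \<le> m"
  proof (rule field_le_epsilon)
    fix e :: real
    assume "0 < e"
    then obtain n where "1 / real (Suc n) < e"
      using reals_Archimedean by (auto simp: inverse_eq_divide)
    with r(2)[of n] show "g r \<le> m + e"
      by linarith
  qed
  with r(1) lower show ?thesis
    by (force simp: attains_min_at_iff)
qed

text \<open>The choice of \<open>t\<close> picks 0 or \<open>q u\<close>, so maximizing over it
  truncates \<open>q u\<close> at 0. The factor \<open>h\<close> is nonnegative and therefore passes
  through the maximum.\<close>

lemma Max_stop_or_continue:
  fixes q :: "'b \<Rightarrow> real"
  assumes "finite U" "U \<noteq> {}" "0 \<le> h"
  shows "(MAX (u, t) \<in> U \<times> {0, 1}. c + h * (t * q u)) = c + h * (MAX u \<in> U. max 0 (q u))"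
    (is "?lhs = ?rhs")
proof (rule antisym)
  have fin: "finite (U \<times> {0, 1::real})" "U \<times> {0, 1::real} \<noteq> {}"
    using assms by auto
  have "h * (t * q u) \<le> h * (MAX u \<in> U. max 0 (q u))" if "u \<in> U" "t \<in> {0, 1}" for u t
  proof (rule mult_left_mono[OF _ assms(3)])
    have "t * q u \<le> max 0 (q u)"
      using that by auto
    also have "\<dots> \<le> (MAX u \<in> U. max 0 (q u))"
      using that assms by (intro Max_ge) auto
    finally show "t * q u \<le> (MAX u \<in> U. max 0 (q u))" .
  qed
  then show "?lhs \<le> ?rhs"
    using fin by (subst Max_le_iff) auto
  have "(MAX u \<in> U. max 0 (q u)) \<in> (\<lambda>u. max 0 (q u)) ` U"
    using assms by (intro Max_in) auto
  then obtain u where u: "u \<in> U" "(MAX u \<in> U. max 0 (q u)) = max 0 (q u)"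
    by auto
  \<comment> \<open>Continuing (\<open>t = 1\<close>) is optimal if \<open>q u\<close> is
    nonnegative, stopping (\<open>t = 0\<close>) otherwise.\<close>
  obtain t :: real where t: "t \<in> {0, 1}" "max 0 (q u) = t * q u"
    by (cases "0 \<le> q u") (auto simp: max_def)
  have "?rhs = (\<lambda>(u, t). c + h * (t * q u)) (u, t)"
    using u t by simp
  also have "\<dots> \<le> ?lhs"
    using u t fin by (intro Max_ge) auto
  finally show "?rhs \<le> ?lhs" .
qed

text \<open>The term at time \<open>n\<close> reads only choices with index below \<open>n\<close>,
  so overwriting the choice at \<open>m\<close> cannot affect it.\<close>

lemma stop_seq_upd: "n \<le> m \<Longrightarrow> stop_seq (\<theta>(m := t)) n = stop_seq \<theta> n"
  by (induction n) auto

lemma state_seq_upd: "n \<le> m \<Longrightarrow> state_seq f x (r(m := a)) (u(m := b)) n = state_seq f x r u n"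
  by (induction n) auto

section \<open>Lower semicontinuity\<close>

text \<open>Lower semicontinuity expressed by a closed epigraph: preimages of the epigraph give
  sublevels, and minimization acts on it by projection.\<close>

definition lsc :: "('a::topological_space \<Rightarrow> real) \<Rightarrow> bool" where
  "lsc V \<longleftrightarrow> closed {(x, a). V x \<le> a}"

text \<open>Given convergent first coordinates, compactness of \<open>K\<close> yields a subsequence
  whose second coordinates converge too; the limit pair stays in \<open>C\<close>.\<close>

lemma closed_projection_compact:
  fixes C :: "('a::metric_space \<times> 'b::metric_space) set"
  assumes "closed C" "compact K" "snd ` C \<subseteq> K"
  shows "closed (fst ` C)"
  unfolding closed_sequential_limits
proof (intro allI impI, elim conjE)
  fix p x
  assume "\<forall>n. p n \<in> fst ` C" and lim: "p \<longlonglongrightarrow> x"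
  then have "\<exists>r. (p n, r) \<in> C" for n
    by force
  then obtain r where r: "\<And>n. (p n, r n) \<in> C"
    by metis
  then have "\<forall>n. r n \<in> K"
    using assms(3) by force
  then obtain s \<rho> where s: "strict_mono \<rho>" "(r \<circ> \<rho>) \<longlonglongrightarrow> s"
    using assms(2) unfolding compact_def by metis
  have "(\<lambda>n. ((p \<circ> \<rho>) n, (r \<circ> \<rho>) n)) \<longlonglongrightarrow> (x, s)"
    using LIMSEQ_subseq_LIMSEQ[OF lim s(1)] s(2) by (rule tendsto_Pair)
  then have "(x, s) \<in> C"
    by (rule closed_sequentially[OF assms(1), rotated]) (simp add: r)
  then show "x \<in> fst ` C"
    by force
qed

section \<open>Standing hypotheses and the one-step operator\<close>

locale minimax_system =
  fixes f :: "'a::metric_space \<Rightarrow> real \<Rightarrow> real \<Rightarrow> 'a"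
    and \<sigma> :: "'a \<Rightarrow> real"
    and \<Omega> U :: "real set"
  assumes compact_\<Omega>: "compact \<Omega>" and \<Omega>_nonempty: "\<Omega> \<noteq> {}"
    and finite_U: "finite U" and U_nonempty: "U \<noteq> {}"
    and continuous_f: "continuous_on (UNIV \<times> \<Omega> \<times> U) (\<lambda>(x, r, u). f x r u)"
    and continuous_\<sigma>: "continuous_on UNIV \<sigma>"
begin

abbreviation \<Lambda> :: "nat \<Rightarrow> 'a \<Rightarrow> real" where
  "\<Lambda> \<equiv> value_iter f \<sigma> \<Omega> U"

lemma worst_next_le_iff: "worst_next f U V x r \<le> a \<longleftrightarrow> (\<forall>u\<in>U. V (f x r u) \<le> a)"
  unfolding worst_next_def using finite_U U_nonempty by (subst Max_le_iff) auto

lemma worst_next_ge: "u \<in> U \<Longrightarrow> V (f x r u) \<le> worst_next f U V x r"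
  using worst_next_le_iff[of V x r "worst_next f U V x r"] by simp

lemma worst_next_mono:
  assumes "\<And>y. V y \<le> W y"
  shows "worst_next f U V x r \<le> worst_next f U W x r"
  unfolding worst_next_le_iff
proof
  fix u
  assume "u \<in> U"
  then show "V (f x r u) \<le> worst_next f U W x r"
    using order_trans[OF assms[of "f x r u"] worst_next_ge[of u W x r]] by blast
qed

lemma worst_next_nonneg:
  assumes "\<And>y. 0 \<le> V y"
  shows "0 \<le> worst_next f U V x r"
proof -
  obtain u where "u \<in> U"
    using U_nonempty by blast
  then show ?thesis
    using order_trans[OF assms[of "f x r u"] worst_next_ge[of u V x r]] by blast
qed

text \<open>Joint continuity of \<open>f\<close> is available only for disturbances in
  \<open>\<Omega>\<close> and controls in \<open>U\<close>, hence the condition on the range of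
  \<open>r\<close>.\<close>

lemma continuous_on_step:
  assumes "u \<in> U" "continuous_on S x" "continuous_on S r" "r ` S \<subseteq> \<Omega>"
  shows "continuous_on S (\<lambda>s. f (x s) (r s) u)"
proof -
  have "continuous_on S (\<lambda>s. (\<lambda>(x, r, u). f x r u) (x s, r s, u))"
    using assms by (intro continuous_on_compose2[OF continuous_f] continuous_intros) auto
  then show ?thesis
    by simp
qed

text \<open>For each \<open>u\<close> the condition on \<open>r\<close> is the preimage of the
  closed epigraph of \<open>V\<close> under a map continuous on \<open>\<Omega>\<close>;
  intersecting over \<open>U\<close> accounts for the maximum.\<close>

lemma compact_worst_next_sublevel:
  assumes "lsc V"
  shows "compact {r \<in> \<Omega>. worst_next f U V x r \<le> a}"
proof -
  have "closed (\<Omega> \<inter> (\<lambda>r. (f x r u, a)) -` {(x, a). V x \<le> a})" if "u \<in> U" for u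
    using that assms compact_\<Omega> unfolding lsc_def
    by (intro continuous_closed_preimage continuous_intros continuous_on_step)
      (auto intro: compact_imp_closed)
  then have "closed (\<Inter>u\<in>U. \<Omega> \<inter> (\<lambda>r. (f x r u, a)) -` {(x, a). V x \<le> a})"
    by (intro closed_INT) auto
  then have "compact (\<Omega> \<inter> (\<Inter>u\<in>U. \<Omega> \<inter> (\<lambda>r. (f x r u, a)) -` {(x, a). V x \<le> a}))"
    by (rule compact_Int_closed[OF compact_\<Omega>])
  also have "\<Omega> \<inter> (\<Inter>u\<in>U. \<Omega> \<inter> (\<lambda>r. (f x r u, a)) -` {(x, a). V x \<le> a}) =
      {r \<in> \<Omega>. worst_next f U V x r \<le> a}"
    by (auto simp: worst_next_le_iff)
  finally show ?thesis .
qed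

lemma minimizer_exists:
  assumes "lsc V" "\<And>y. 0 \<le> V y"
  obtains r where "attains_min_at \<Omega> (worst_next f U V x) r"
proof -
  have "\<exists>r. attains_min_at \<Omega> (worst_next f U V x) r"
    by (intro attains_min_at_compact_sublevels \<Omega>_nonempty worst_next_nonneg
        compact_worst_next_sublevel assms)
  with that show ?thesis
    by blast
qed

lemma lsc_bellman:
  assumes "lsc V" "\<And>y. 0 \<le> V y"
  shows "lsc (\<lambda>x. max 0 (\<sigma> x + min_over \<Omega> (worst_next f U V x)))"
proof -
  \<comment> \<open>The epigraph is, above height 0, the projection along \<open>\<Omega>\<close> of a closed set \<open>C\<close>.\<close>
  define D :: "(('a \<times> real) \<times> real) set" where "D = UNIV \<times> \<Omega>"
  define C where "C = D \<inter>
    (\<Inter>u\<in>U. D \<inter> (\<lambda>p. (f (fst (fst p)) (snd p) u, snd (fst p) - \<sigma> (fst (fst p)))) -`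
      {(x, a). V x \<le> a})"
  have "closed D"
    unfolding D_def by (intro closed_Times closed_UNIV compact_imp_closed compact_\<Omega>)
  then have "closed C"
    unfolding C_def using assms(1) unfolding lsc_def
    by (intro closed_Int closed_INT continuous_closed_preimage continuous_intros
        continuous_on_step ballI continuous_on_compose2[OF continuous_\<sigma>]) (auto simp: D_def)
  moreover have "snd ` C \<subseteq> \<Omega>"
    by (auto simp: C_def D_def)
  ultimately have "closed (fst ` C)"
    using closed_projection_compact compact_\<Omega> by blast
  \<comment> \<open>Restricting to nonnegative heights accounts for the truncation
    \<open>max 0\<close>.\<close>
  then have "closed (fst ` C \<inter> UNIV \<times> {0..})"
    by (intro closed_Int closed_Times) auto
  also have "fst ` C \<inter> UNIV \<times> {0..} =
      {(x, a). max 0 (\<sigma> x + min_over \<Omega> (worst_next f U V x)) \<le> a}"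
  proof (rule set_eqI, clarify)
    fix x :: 'a and a :: real
    obtain r where r: "attains_min_at \<Omega> (worst_next f U V x) r"
      using assms by (rule minimizer_exists)
    have "(x, a) \<in> fst ` C \<longleftrightarrow> (\<exists>r\<in>\<Omega>. worst_next f U V x r \<le> a - \<sigma> x)"
      by (force simp: C_def D_def worst_next_le_iff)
    \<comment> \<open>Attainment matters here: a bound on the minimum must be realized by an actual
      point of \<open>\<Omega>\<close>, including in the case of equality.\<close>
    also have "\<dots> \<longleftrightarrow> min_over \<Omega> (worst_next f U V x) \<le> a - \<sigma> x"
      using r min_over_eq[OF r] order_trans by (auto simp: attains_min_at_iff)
    finally show "(x, a) \<in> fst ` C \<inter> UNIV \<times> {0..} \<longleftrightarrow>
        (x, a) \<in> {(x, a). max 0 (\<sigma> x + min_over \<Omega> (worst_next f U V x)) \<le> a}"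
      by auto
  qed
  finally show ?thesis
    by (simp add: lsc_def)
qed

section \<open>Value iteration\<close>

lemma value_iter_nonneg: "0 \<le> \<Lambda> k x"
  by (cases k) auto

lemma lsc_value_iter: "lsc (\<Lambda> k)"
proof (induction k)
  case 0
  have "{(x :: 'a, a :: real). 0 \<le> a} = UNIV \<times> {0..}"
    by auto
  then show ?case
    by (simp add: lsc_def closed_Times)
next
  case (Suc k)
  then show ?case
    using lsc_bellman[OF Suc] value_iter_nonneg by (simp add: fun_eq_iff)
qed

lemma value_iter_minimizer:
  obtains r where "attains_min_at \<Omega> (worst_next f U (\<Lambda> k) x) r"
  using minimizer_exists[OF lsc_value_iter value_iter_nonneg] .

text \<open>The Bellman operator is monotone and the iteration starts from 0, below its first
  iterate.\<close>

lemma value_iter_Suc_mono: "\<Lambda> k x \<le> \<Lambda> (Suc k) x"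
proof (induction k arbitrary: x)
  case 0
  show ?case
    by simp
next
  case (Suc k)
  obtain r where r: "attains_min_at \<Omega> (worst_next f U (\<Lambda> k) x) r"
    by (rule value_iter_minimizer)
  obtain s where s: "attains_min_at \<Omega> (worst_next f U (\<Lambda> (Suc k)) x) s"
    by (rule value_iter_minimizer)
  have "min_over \<Omega> (worst_next f U (\<Lambda> k) x) \<le> min_over \<Omega> (worst_next f U (\<Lambda> (Suc k)) x)"
    by (rule min_over_mono[OF r s worst_next_mono[OF Suc]])
  then show ?case
    using value_iter.simps(2)[of f \<sigma> \<Omega> U k x] value_iter.simps(2)[of f \<sigma> \<Omega> U "Suc k" x]
    by linarith
qed

lemma incseq_value_iter: "incseq (\<lambda>k. \<Lambda> k x)"
  by (rule incseq_SucI) (rule value_iter_Suc_mono)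

text \<open>Monotonicity of the Bellman operator carries the induction. Nonnegativity of
  \<open>V\<close> gives the base case and the 0 branch of the truncation.\<close>

lemma value_iter_le_supersolution:
  assumes "bellman_supersolution f \<sigma> \<Omega> U V"
  shows "\<Lambda> k x \<le> V x"
proof (induction k arbitrary: x)
  case 0
  then show ?case
    using assms by (simp add: bellman_supersolution_def)
next
  case (Suc k)
  obtain r where r: "attains_min_at \<Omega> (worst_next f U (\<Lambda> k) x) r"
    by (rule value_iter_minimizer)
  obtain s where s: "attains_min_at \<Omega> (worst_next f U V x) s"
    using assms by (auto simp: bellman_supersolution_def)
  have "min_over \<Omega> (worst_next f U (\<Lambda> k) x) \<le> min_over \<Omega> (worst_next f U V x)"
    by (rule min_over_mono[OF r s worst_next_mono[OF Suc]])
  moreover have "0 \<le> V x" "\<sigma> x + min_over \<Omega> (worst_next f U V x) \<le> V x"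
    using assms by (auto simp: bellman_supersolution_def)
  ultimately show ?case
    by simp
qed

lemma bellman_solution_imp_supersolution:
  assumes "bellman_solution f \<sigma> \<Omega> U V"
  shows "bellman_supersolution f \<sigma> \<Omega> U V"
  unfolding bellman_supersolution_def
proof (intro conjI allI)
  fix x
  have "V x = max 0 (\<sigma> x + min_over \<Omega> (worst_next f U V x))"
    using assms by (simp add: bellman_solution_def)
  then show "\<sigma> x + min_over \<Omega> (worst_next f U V x) \<le> V x"
    by linarith
qed (use assms in \<open>simp_all add: bellman_solution_def\<close>)

section \<open>Pointwise limit of the iterates\<close>

lemma bounded_imp_value_iter_limit:
  assumes "\<And>x. \<exists>B. \<forall>k. \<Lambda> k x \<le> B"
  shows "\<exists>L. value_iter_limit f \<sigma> \<Omega> U L"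
proof -
  have "\<exists>l. (\<lambda>k. \<Lambda> k x) \<longlonglongrightarrow> l" for x
    using assms[of x] incseq_convergent[OF incseq_value_iter] by metis
  then obtain L where L: "\<And>x. (\<lambda>k. \<Lambda> k x) \<longlonglongrightarrow> L x"
    by metis
  moreover have "0 \<le> L x" for x
    by (rule LIMSEQ_le_const[OF L]) (simp add: value_iter_nonneg)
  ultimately show ?thesis
    unfolding value_iter_limit_def by blast
qed

lemma value_iter_le_limit:
  assumes "value_iter_limit f \<sigma> \<Omega> U L"
  shows "\<Lambda> k x \<le> L x"
proof (rule incseq_le[OF incseq_value_iter])
  show "(\<lambda>k. \<Lambda> k x) \<longlonglongrightarrow> L x"
    using assms by (simp add: value_iter_limit_def)
qed

text \<open>The limit of an increasing sequence is its supremum, so upper bounds on \<open>L\<close>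
  can be checked on the iterates.\<close>

lemma value_iter_limit_le_iff:
  assumes "value_iter_limit f \<sigma> \<Omega> U L"
  shows "L x \<le> a \<longleftrightarrow> (\<forall>k. \<Lambda> k x \<le> a)"
proof
  show "\<forall>k. \<Lambda> k x \<le> a" if "L x \<le> a"
    using order_trans[OF value_iter_le_limit[OF assms] that] by simp
  show "L x \<le> a" if "\<forall>k. \<Lambda> k x \<le> a"
    by (rule LIMSEQ_le_const2[of "\<lambda>k. \<Lambda> k x"]) (use assms that in \<open>simp_all add: value_iter_limit_def\<close>)
qed

text \<open>The point is to exchange the minimum over \<open>\<Omega>\<close> with the increasing
  limit in \<open>k\<close>, and to find a minimizer for \<open>L\<close>, by compactness of
  sublevels.\<close>

lemma value_iter_limit_solution:
  assumes "value_iter_limit f \<sigma> \<Omega> U L"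
  shows "bellman_solution f \<sigma> \<Omega> U L"
  unfolding bellman_solution_def
proof (intro conjI allI)
  fix x
  show "0 \<le> L x"
    using assms by (simp add: value_iter_limit_def)
  define m where "m k = min_over \<Omega> (worst_next f U (\<Lambda> k) x)" for k
  \<comment> \<open>Since \<Lambda> at \<open>Suc k\<close> dominates
    \<open>\<sigma> x + m k\<close> and lies below \<open>L x\<close>, the minima are bounded and
    will converge.\<close>
  have m_le: "m k \<le> L x - \<sigma> x" for k
    using value_iter_le_limit[OF assms, of "Suc k" x] by (simp add: m_def)
  have m_mono: "incseq m"
  proof (rule incseq_SucI)
    fix k
    obtain r where r: "attains_min_at \<Omega> (worst_next f U (\<Lambda> k) x) r"
      by (rule value_iter_minimizer)
    obtain s where s: "attains_min_at \<Omega> (worst_next f U (\<Lambda> (Suc k)) x) s"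
      by (rule value_iter_minimizer)
    show "m k \<le> m (Suc k)"
      unfolding m_def by (rule min_over_mono[OF r s worst_next_mono[OF value_iter_Suc_mono]])
  qed
  obtain c where c: "m \<longlonglongrightarrow> c"
    using m_mono m_le incseq_convergent by metis
  have m_le_c: "m k \<le> c" for k
    using incseq_le[OF m_mono c] .
  \<comment> \<open>All levels equal the limit \<open>c\<close> of the minima: a minimizer for stage
    \<open>k\<close> belongs to \<open>F k\<close> because \<open>m k\<close> is at most
    \<open>c\<close>, and \<open>F\<close> decreases because the iterates increase.\<close>
  define F where "F k = {r \<in> \<Omega>. worst_next f U (\<Lambda> k) x r \<le> c}" for k
  have "F k \<noteq> {}" for k
  proof -
    obtain r where r: "attains_min_at \<Omega> (worst_next f U (\<Lambda> k) x) r"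
      by (rule value_iter_minimizer)
    then have "r \<in> F k"
      using m_le_c[of k] min_over_eq[OF r] by (simp add: F_def m_def attains_min_at_iff)
    then show ?thesis
      by blast
  qed
  moreover have "compact (F k)" for k
    unfolding F_def by (rule compact_worst_next_sublevel[OF lsc_value_iter])
  moreover have "F n \<subseteq> F k" if "k \<le> n" for k n
    using order_trans[OF worst_next_mono[of "\<Lambda> k" "\<Lambda> n", OF incseqD[OF incseq_value_iter that]]]
    by (auto simp: F_def)
  ultimately have "\<Inter> (range F) \<noteq> {}"
    by (intro compact_nest) auto
  then obtain r where r: "r \<in> \<Omega>" "\<And>k. worst_next f U (\<Lambda> k) x r \<le> c"
    by (auto simp: F_def)
  \<comment> \<open>The common point \<open>r\<close> satisfies the bound for all \<open>k\<close>
    and all \<open>u\<close>, so the bound survives the passage to \<open>L\<close>.\<close>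
  have upper: "worst_next f U L x r \<le> c"
    using r(2) by (simp add: worst_next_le_iff value_iter_limit_le_iff[OF assms])
  have lower: "c \<le> worst_next f U L x s" if s: "s \<in> \<Omega>" for s
  proof (rule LIMSEQ_le_const2[OF c], intro exI[of _ 0] allI impI)
    fix k
    obtain t where t: "attains_min_at \<Omega> (worst_next f U (\<Lambda> k) x) t"
      by (rule value_iter_minimizer)
    have "m k \<le> worst_next f U (\<Lambda> k) x s"
      unfolding m_def using t s by (rule min_over_le)
    also have "\<dots> \<le> worst_next f U L x s"
      by (rule worst_next_mono[OF value_iter_le_limit[OF assms]])
    finally show "m k \<le> worst_next f U L x s" .
  qed
  have att: "attains_min_at \<Omega> (worst_next f U L x) r"
    using r(1) order_trans[OF upper lower] by (simp add: attains_min_at_iff)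
  then show "\<exists>r. attains_min_at \<Omega> (worst_next f U L x) r"
    by blast
  have "min_over \<Omega> (worst_next f U L x) = c"
    using min_over_eq[OF att] upper lower[OF r(1)] by simp
  moreover have "(\<lambda>k. \<Lambda> (Suc k) x) \<longlonglongrightarrow> max 0 (\<sigma> x + c)"
    using c unfolding value_iter.simps m_def by (intro tendsto_intros)
  moreover have "(\<lambda>k. \<Lambda> (Suc k) x) \<longlonglongrightarrow> L x"
    using assms by (intro LIMSEQ_Suc) (simp add: value_iter_limit_def)
  ultimately show "L x = max 0 (\<sigma> x + min_over \<Omega> (worst_next f U L x))"
    using LIMSEQ_unique by metis
qed

section \<open>The game value\<close>

text \<open>Dynamic programming by backward optimization: the past payoff is constant, and the
  current state summarizes the future. There is no truncation at 0 here, because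
  \<open>\<theta> n\<close> is already chosen and sits inside
  \<open>stop_seq \<theta> (Suc n)\<close>. A nonnegative stopping factor can be moved through
  minima and maxima.\<close>

lemma stages_payoff:
  assumes "0 \<le> stop_seq \<theta> (Suc n)"
  shows "stages \<Omega> U (payoff f \<sigma> (Suc (n + k)) x) k n \<theta> r u =
    payoff f \<sigma> n x \<theta> r u + stop_seq \<theta> (Suc n) *
      (\<sigma> (state_seq f x r u n) + min_over \<Omega> (worst_next f U (\<Lambda> k) (state_seq f x r u n)))"
  using assms
proof (induction k arbitrary: n \<theta> r u)
  case 0
  \<comment> \<open>A minimizer is needed even for the zero function in order to evaluate
    \<open>min_over\<close> to 0.\<close>
  obtain s where s: "attains_min_at \<Omega> (worst_next f U (\<Lambda> 0) (state_seq f x r u n)) s"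
    by (rule value_iter_minimizer)
  have "worst_next f U (\<Lambda> 0) (state_seq f x r u n) s = 0"
    using U_nonempty finite_U by (simp add: worst_next_def image_constant_conv)
  then show ?case
    using min_over_eq[OF s] by (simp add: payoff_def del: value_iter.simps)
next
  case (Suc k)
  define y where "y = state_seq f x r u n"
  define h where "h = stop_seq \<theta> (Suc n)"
  define c where "c = payoff f \<sigma> n x \<theta> r u + h * \<sigma> y"
  \<comment> \<open>The value at \<open>z\<close> of continuing, before the option to stop truncates
    it at 0.\<close>
  define q where "q z = \<sigma> z + min_over \<Omega> (worst_next f U (\<Lambda> k) z)" for z
  have h: "0 \<le> h"
    using Suc.prems by (simp add: h_def)
  have step: "stages \<Omega> U (payoff f \<sigma> (Suc (n + Suc k)) x) k (Suc n)
      (\<theta>(Suc n := t)) (r(n := a)) (u(n := b)) = c + h * (t * q (f y a b))"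
    if "t \<in> {0, 1}" for t a b
  proof -
    have stop: "stop_seq (\<theta>(Suc n := t)) (Suc (Suc n)) = t * h"
      using stop_seq_upd[of "Suc n" "Suc n" \<theta> t] by (simp add: h_def)
    have state: "state_seq f x (r(n := a)) (u(n := b)) (Suc n) = f y a b"
      by (simp add: y_def state_seq_upd)
    \<comment> \<open>The term at time \<open>n\<close> uses the state and stopping factor fixed
      before this stage, so it moves from the future into the past.\<close>
    have prefix: "payoff f \<sigma> (Suc n) x (\<theta>(Suc n := t)) (r(n := a)) (u(n := b)) = c"
      unfolding payoff_def c_def h_def y_def sum.lessThan_Suc
      by (intro arg_cong2[where f = "(+)"] sum.cong refl)
        (simp_all add: stop_seq_upd state_seq_upd del: stop_seq.simps)
    have "0 \<le> stop_seq (\<theta>(Suc n := t)) (Suc (Suc n))"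
      unfolding stop using that h by auto
    from Suc.IH[OF this, of "r(n := a)" "u(n := b)", unfolded stop state prefix]
    show ?thesis
      by (simp add: q_def mult.left_commute fun_upd_def)
  qed
  have q: "max 0 (q z) = \<Lambda> (Suc k) z" for z
    by (simp add: q_def)
  have max_step: "(MAX (b, t) \<in> U \<times> {0, 1}. stages \<Omega> U (payoff f \<sigma> (Suc (n + Suc k)) x) k (Suc n)
      (\<theta>(Suc n := t)) (r(n := a)) (u(n := b))) = c + h * worst_next f U (\<Lambda> (Suc k)) y a" for a
  proof -
    \<comment> \<open>The rewriting goes through the image because \<open>step\<close> is available
      only for \<open>t\<close> in \<open>{0, 1}\<close>.\<close>
    have "(\<lambda>(b, t). stages \<Omega> U (payoff f \<sigma> (Suc (n + Suc k)) x) k (Suc n)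
        (\<theta>(Suc n := t)) (r(n := a)) (u(n := b))) ` (U \<times> {0, 1}) =
      (\<lambda>(b, t). c + h * (t * q (f y a b))) ` (U \<times> {0, 1})"
    proof (intro image_cong refl)
      fix p
      assume "p \<in> U \<times> {0, 1::real}"
      then show "(case p of (b, t) \<Rightarrow> stages \<Omega> U (payoff f \<sigma> (Suc (n + Suc k)) x) k (Suc n)
          (\<theta>(Suc n := t)) (r(n := a)) (u(n := b))) = (case p of (b, t) \<Rightarrow> c + h * (t * q (f y a b)))"
        using step by (cases p) (simp only: case_prod_conv mem_Times_iff fst_conv snd_conv)
    qed
    then show ?thesis
      using Max_stop_or_continue[OF finite_U U_nonempty h, of c "\<lambda>b. q (f y a b)"]
      by (simp only: q worst_next_def)
  qed
  obtain s where s: "attains_min_at \<Omega> (worst_next f U (\<Lambda> (Suc k)) y) s"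
    by (rule value_iter_minimizer)
  show ?case
    unfolding stages.simps max_step min_over_affine[OF s h]
    by (simp only: c_def h_def y_def distrib_left add.assoc)
qed

text \<open>For \<open>n = 0\<close> the past payoff is empty and the stopping factor is the first
  choice \<open>t\<close>; the outermost maximum over \<open>t\<close> supplies the missing
  truncation.\<close>

lemma game_value_eq_value_iter: "game_value f \<sigma> \<Omega> U k x = \<Lambda> k x"
proof (cases k)
  case 0
  then show ?thesis
    by simp
next
  case (Suc j)
  have "stages \<Omega> U (payoff f \<sigma> (Suc j) x) j 0 ((\<lambda>_. 0)(0 := t)) (\<lambda>_. 0) (\<lambda>_. 0) =
      t * (\<sigma> x + min_over \<Omega> (worst_next f U (\<Lambda> j) x))" if "t \<in> {0, 1}" for t
    using stages_payoff[of "(\<lambda>_. 0)(0 := t)" 0 j x "\<lambda>_. 0" "\<lambda>_. 0"] that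
    by (auto simp: payoff_def)
  then show ?thesis
    by (simp add: Suc)
qed

section \<open>Finiteness of the supremum and convergence of the iterates\<close>

lemma game_value_sup_le_iff:
  "game_value_sup f \<sigma> \<Omega> U x \<le> ereal a \<longleftrightarrow> (\<forall>k. \<Lambda> k x \<le> a)"
  by (simp add: game_value_sup_def SUP_le_iff game_value_eq_value_iter)

lemma game_value_sup_eq_limit:
  assumes "value_iter_limit f \<sigma> \<Omega> U L"
  shows "game_value_sup f \<sigma> \<Omega> U x = ereal (L x)"
proof -
  have "(\<lambda>k. ereal (\<Lambda> k x)) \<longlonglongrightarrow> ereal (L x)"
    using assms by (simp add: value_iter_limit_def)
  then show ?thesis
    unfolding game_value_sup_def game_value_eq_value_iter
    by (rule SUP_Lim[rotated]) (use incseq_value_iter in \<open>simp add: incseq_def\<close>)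
qed

lemma game_value_sup_finite_imp_limit:
  assumes "\<And>x. game_value_sup f \<sigma> \<Omega> U x < \<infinity>"
  shows "\<exists>L. value_iter_limit f \<sigma> \<Omega> U L"
proof (rule bounded_imp_value_iter_limit)
  fix x
  obtain B where "game_value_sup f \<sigma> \<Omega> U x \<le> ereal B"
    using assms[of x] by (cases "game_value_sup f \<sigma> \<Omega> U x") auto
  then show "\<exists>B. \<forall>k. \<Lambda> k x \<le> B"
    by (auto simp: game_value_sup_le_iff)
qed

text \<open>A telescoping estimate: at a minimizing \<open>r n\<close>, any control leaves
  \<open>V\<close> at the next state at most \<open>V (x n) - \<sigma> (x n)\<close>. Keeping the
  terminal value on the left lets the induction close.\<close>

lemma minimizing_trajectory_sum_le:
  assumes V: "bellman_supersolution f \<sigma> \<Omega> U V"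
    and traj: "minimizing_trajectory f \<Omega> U V x r u"
  shows "(\<Sum>n<\<tau>. \<sigma> (x n)) + V (x \<tau>) \<le> V (x 0)"
proof (induction \<tau>)
  case 0
  show ?case
    by simp
next
  case (Suc n)
  have r: "attains_min_at \<Omega> (worst_next f U V (x n)) (r n)"
    and u: "u n \<in> U" and x: "x (Suc n) = f (x n) (r n) (u n)"
    using traj by (auto simp: minimizing_trajectory_def)
  have "V (x (Suc n)) \<le> min_over \<Omega> (worst_next f U V (x n))"
    unfolding x min_over_eq[OF r] using u by (rule worst_next_ge)
  moreover have "\<sigma> (x n) + min_over \<Omega> (worst_next f U V (x n)) \<le> V (x n)"
    using V by (simp add: bellman_supersolution_def)
  ultimately show ?case
    using Suc by simp
qed

text \<open>Dropping the nonnegative terminal value leaves the bound \<open>V (x 0)\<close>,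
  independent of the horizon.\<close>

lemma minimizing_trajectory_bounded:
  assumes "bellman_supersolution f \<sigma> \<Omega> U V" "minimizing_trajectory f \<Omega> U V x r u"
  shows "(SUP \<tau>. ereal (\<Sum>n<\<tau>. \<sigma> (x n))) < \<infinity>"
proof -
  have "(\<Sum>n<\<tau>. \<sigma> (x n)) \<le> V (x 0)" for \<tau>
    using minimizing_trajectory_sum_le[OF assms, of \<tau>] assms(1)
    by (simp add: bellman_supersolution_def) (metis le_add_same_cancel1 order_trans)
  then have "(SUP \<tau>. ereal (\<Sum>n<\<tau>. \<sigma> (x n))) \<le> ereal (V (x 0))"
    by (intro SUP_least) simp
  then show ?thesis
    by (rule order.strict_trans1) simp
qed

end

theorem theorem1:
  fixes f :: "'a::metric_space \<Rightarrow> real \<Rightarrow> real \<Rightarrow> 'a"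
    and \<sigma> :: "'a \<Rightarrow> real"
    and \<Omega> U :: "real set"
  assumes "compact \<Omega>" and "\<Omega> \<noteq> {}"
    and "finite U" and "U \<noteq> {}"
    and "continuous_on (UNIV \<times> \<Omega> \<times> U) (\<lambda>(x, r, u). f x r u)"
    and "continuous_on UNIV \<sigma>"
  shows
    "((\<forall>x. game_value_sup f \<sigma> \<Omega> U x < \<infinity>) \<longleftrightarrow> (\<exists>L. value_iter_limit f \<sigma> \<Omega> U L)) \<and>
     ((\<exists>L. value_iter_limit f \<sigma> \<Omega> U L) \<longleftrightarrow> (\<exists>V. bellman_solution f \<sigma> \<Omega> U V)) \<and>
     ((\<exists>V. bellman_solution f \<sigma> \<Omega> U V) \<longleftrightarrow> (\<exists>V. bellman_supersolution f \<sigma> \<Omega> U V)) \<and>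
     ((\<forall>x. game_value_sup f \<sigma> \<Omega> U x < \<infinity>) \<longrightarrow>
        bellman_solution f \<sigma> \<Omega> U (\<lambda>x. real_of_ereal (game_value_sup f \<sigma> \<Omega> U x)) \<and>
        (\<forall>L. value_iter_limit f \<sigma> \<Omega> U L \<longrightarrow> (\<forall>x. game_value_sup f \<sigma> \<Omega> U x = ereal (L x))) \<and>
        (\<forall>k x. game_value_sup f \<sigma> \<Omega> U x \<ge> ereal (game_value f \<sigma> \<Omega> U k x)) \<and>
        (\<forall>k x. game_value f \<sigma> \<Omega> U k x = value_iter f \<sigma> \<Omega> U k x) \<and>
        (\<forall>V. bellman_solution f \<sigma> \<Omega> U V \<longrightarrow> (\<forall>x. ereal (V x) \<ge> game_value_sup f \<sigma> \<Omega> U x)) \<and>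
        (\<forall>V x r u. bellman_supersolution f \<sigma> \<Omega> U V \<longrightarrow> minimizing_trajectory f \<Omega> U V x r u \<longrightarrow>
           (SUP \<tau>. ereal (\<Sum>n<\<tau>. \<sigma> (x n))) < \<infinity>))"
proof -
  interpret minimax_system f \<sigma> \<Omega> U
    using assms by unfold_locales
  have i_ii: "(\<forall>x. game_value_sup f \<sigma> \<Omega> U x < \<infinity>) \<longleftrightarrow> (\<exists>L. value_iter_limit f \<sigma> \<Omega> U L)"
    using game_value_sup_finite_imp_limit game_value_sup_eq_limit by fastforce
  \<comment> \<open>A supersolution bounds all iterates, which gives (ii) from (iv) and closes the
    cycle through (iii).\<close>
  have iv_i: "\<exists>L. value_iter_limit f \<sigma> \<Omega> U L" if "bellman_supersolution f \<sigma> \<Omega> U V" for V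
    using value_iter_le_supersolution[OF that] by (intro bounded_imp_value_iter_limit) blast
  have equivalences:
    "(\<exists>L. value_iter_limit f \<sigma> \<Omega> U L) \<longleftrightarrow> (\<exists>V. bellman_solution f \<sigma> \<Omega> U V)"
    "(\<exists>V. bellman_solution f \<sigma> \<Omega> U V) \<longleftrightarrow> (\<exists>V. bellman_supersolution f \<sigma> \<Omega> U V)"
    using iv_i value_iter_limit_solution bellman_solution_imp_supersolution by blast+
  \<comment> \<open>Finiteness provides a limit \<open>L\<close>, and taking real parts of
    \<open>game_value_sup\<close> recovers exactly this \<open>L\<close>.\<close>
  have sup_solution: "bellman_solution f \<sigma> \<Omega> U (\<lambda>x. real_of_ereal (game_value_sup f \<sigma> \<Omega> U x))"
    if "\<forall>x. game_value_sup f \<sigma> \<Omega> U x < \<infinity>"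
    using that i_ii value_iter_limit_solution game_value_sup_eq_limit by fastforce
  have sup_ge: "ereal (game_value f \<sigma> \<Omega> U k x) \<le> game_value_sup f \<sigma> \<Omega> U x" for k x
    unfolding game_value_sup_def by (rule SUP_upper) simp
  have sup_least: "game_value_sup f \<sigma> \<Omega> U x \<le> ereal (V x)" if "bellman_solution f \<sigma> \<Omega> U V" for V x
    using value_iter_le_supersolution[OF bellman_solution_imp_supersolution[OF that]]
    by (simp add: game_value_sup_le_iff)
  show ?thesis
    using i_ii equivalences sup_solution sup_ge sup_least game_value_eq_value_iter
      game_value_sup_eq_limit minimizing_trajectory_bounded by blast
qed

end
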